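(* Let $\mathcal{T}\in\mathbb{R}^{I\times J\times K}$, $R\ge1$. Let $\mathbf{M}=\bar{\mathbf{V}}\mathbf{S}\bar{\mathbf{V}}^T$ with $\bar{\mathbf{V}}\in\mathbb{R}^{JK\times JK}$ orthogonal with columns $\bar{\mathbf{v}}_i$ and $\mathbf{S}=\mathrm{diag}(\lambda_1,\dots,\lambda_{JK})$, let $\bar{\mathbf{V}}_i\in\mathbb{R}^{J\times K}$ be the matricization of $\bar{\mathbf{v}}_i$, and let $\sigma_k^i$ be the $k$-th singular value (in nonincreasing order) of $\bar{\mathbf{V}}_i$. Then $$\inf_{(\mathbf{B},\mathbf{C})}\mathfrak{J}_{red}(\mathbf{B},\mathbf{C})\ \ge\ \frac12\sum_{i=1}^{JK}\lambda_i\left(\sum_{k=R+1}^{\min(J,K)}(\sigma_k^i)^2\right),$$ the infimum being over all $\mathbf{B}\in\mathbb{R}^{J\times R}$, $\mathbf{C}\in\mathbb{R}^{K\times R}$.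
   Context: $I,J,K,R$ are positive integers. For $\mathbf{A}\in\mathbb{R}^{I\times R}$, $\mathbf{B}\in\mathbb{R}^{J\times R}$, $\mathbf{C}\in\mathbb{R}^{K\times R}$ with entries $a_{ir},b_{jr},c_{kr}$, put $$\mathfrak{J}(\mathbf{A},\mathbf{B},\mathbf{C})=\tfrac12\sum_{i,j,k}\Big(\mathcal{T}_{ijk}-\sum_{r=1}^R a_{ir}b_{jr}c_{kr}\Big)^2,\qquad \mathfrak{J}_{red}(\mathbf{B},\mathbf{C})=\min_{\mathbf{A}\in\mathbb{R}^{I\times R}}\mathfrak{J}(\mathbf{A},\mathbf{B},\mathbf{C}).$$ $\mathbf{M}\in\mathbb{R}^{JK\times JK}$ is the symmetric matrix whose entry at row $\alpha+(\beta-1)J$ and column $\gamma+(\delta-1)J$ is $\sum_{i=1}^I\mathcal{T}_{i\alpha\beta}\mathcal{T}_{i\gamma\delta}$, for $1\le\alpha,\gamma\le J$, $1\le\beta,\delta\le K$. The matricization of $\mathbf{v}\in\mathbb{R}^{JK}$ is the $J\times K$ matrix whose $(j,k)$ entry is the entry of $\mathbf{v}$ at position $j+(k-1)J$. An empty sum is $0$. *)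

theory Defs
  imports "Jordan_Normal_Form.Char_Poly"
begin

(* All indices are 0-based.  A tensor of size I x J x K is a function T of which only the entries
   T i j k with i < I, j < J, k < K are used. *)

definition cost :: "nat \<Rightarrow> nat \<Rightarrow> nat \<Rightarrow> nat \<Rightarrow> (nat \<Rightarrow> nat \<Rightarrow> nat \<Rightarrow> real) \<Rightarrow>
    real mat \<Rightarrow> real mat \<Rightarrow> real mat \<Rightarrow> real" where
  "cost I J K R T A B C =
     1 / 2 * (\<Sum>i<I. \<Sum>j<J. \<Sum>k<K.
       (T i j k - (\<Sum>r<R. A $$ (i, r) * B $$ (j, r) * C $$ (k, r)))\<^sup>2)"

(* LEAST rather than Inf: the minimum over A is attained (linear least squares), and the
   definition denotes the attained minimum. *)
definition cost_red :: "nat \<Rightarrow> nat \<Rightarrow> nat \<Rightarrow> nat \<Rightarrow> (nat \<Rightarrow> nat \<Rightarrow> nat \<Rightarrow> real) \<Rightarrow>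
    real mat \<Rightarrow> real mat \<Rightarrow> real" where
  "cost_red I J K R T B C = (LEAST c. \<exists>A \<in> carrier_mat I R. c = cost I J K R T A B C)"

(* A position p < J * K is decoded as p = \<alpha> + \<beta> * J with \<alpha> = p mod J and \<beta> = p div J. *)
definition slice_gram :: "nat \<Rightarrow> nat \<Rightarrow> nat \<Rightarrow> (nat \<Rightarrow> nat \<Rightarrow> nat \<Rightarrow> real) \<Rightarrow> real mat" where
  "slice_gram I J K T = mat (J * K) (J * K)
     (\<lambda>(p, q). \<Sum>i<I. T i (p mod J) (p div J) * T i (q mod J) (q div J))"

definition matricization :: "nat \<Rightarrow> nat \<Rightarrow> real vec \<Rightarrow> real mat" where
  "matricization J K v = mat J K (\<lambda>(j, k). v $ (j + k * J))"

(* The square roots of the eigenvalues of the Gram matrix, repeated according to algebraic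
   multiplicity and in nonincreasing order.  The Gram matrix has dim_col A eigenvalues; those
   beyond the first min (dim_row A) (dim_col A) are zero and are dropped. *)
definition singular_values :: "real mat \<Rightarrow> real list" where
  "singular_values A = take (min (dim_row A) (dim_col A))
     (rev (sorted_list_of_multiset (image_mset sqrt (proots (char_poly (transpose_mat A * A))))))"

(* The k-th singular value, counted from k = 1. *)
definition singular_value :: "real mat \<Rightarrow> nat \<Rightarrow> real" where
  "singular_value A k = singular_values A ! (k - 1)"

end

theory Submission
  imports Defs
begin

text \<open>
Fix \<open>B\<close> and \<open>C\<close>. Let \<open>X\<close> be the \<open>J K \<times> I\<close> matrix whose columns are the vectorised slices of the
tensor, and let \<open>W\<close> be the \<open>J K \<times> R\<close> matrix whose columns are the vectorised rank-one matrices
\<open>b\<^sub>r c\<^sub>r\<^sup>T\<close>. The cost of \<open>A\<close> is half the squared Frobenius norm of \<open>X - W A\<^sup>T\<close>. If \<open>Q\<close> is the orthogonal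
projection onto the orthogonal complement of the column space of \<open>W\<close>, the minimum over \<open>A\<close> is
attained and equals half the squared norm of \<open>Q X\<close> (lemma \<open>cost_red_eq_projection\<close>). As
\<open>M = X X\<^sup>T = V diag(l) V\<^sup>T\<close>, this squared norm is
\<open>trace (Q M) = \<Sum>\<^sub>i l\<^sub>i (V\<^sup>T Q V)\<^sub>i\<^sub>i = \<Sum>\<^sub>i l\<^sub>i \<parallel>Q v\<^sub>i\<parallel>\<^sup>2\<close>, with all \<open>l\<^sub>i \<ge> 0\<close> because \<open>M\<close> is a Gram matrix.
Finally \<open>Q v\<^sub>i = v\<^sub>i - W g\<close> for some \<open>g\<close>, and \<open>W g\<close> is the vectorisation of a matrix that factors
through dimension \<open>R\<close>; so \<open>\<parallel>Q v\<^sub>i\<parallel>\<^sup>2\<close> is at least the sum of the squares of all but the \<open>R\<close> largest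
singular values of the matricization of \<open>v\<^sub>i\<close>, by the lower bound of the Eckart-Young theorem
(\<open>eckart_young_lower\<close>).

The Eckart-Young bound for \<open>A - Y Z\<close> is obtained by projecting again, now onto the orthogonal
complement of the row space of \<open>Z\<close>: this annihilates \<open>Y Z\<close>, does not increase the norm, and leaves a
sum of the eigenvalues of \<open>A\<^sup>T A\<close> with weights in \<open>[0, 1]\<close> and of total weight at least \<open>K - R\<close>. Such
a sum is smallest when the weight is put on the smallest eigenvalues
(\<open>weighted_sum_list_ge\<close>). Both projections come from \<open>residual_projection\<close>, which rests on the
spectral theorem for real symmetric matrices (\<open>real_spectral\<close>); the latter is proved by deflation
with Householder reflections.
\<close>

section \<open>Trace and Frobenius norm\<close>

text \<open>
The next four laws carry side conditions on dimensions instead of carrier sets, so that the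
simplifier can use them for rectangular matrices without guessing a carrier.
\<close>

lemma mat_assoc:
  fixes A B C :: "'a :: comm_ring_1 mat"
  assumes "dim_col A = dim_row B" "dim_col B = dim_row C"
  shows "A * B * C = A * (B * C)"
  by (rule assoc_mult_mat[of A "dim_row A" "dim_row B" B "dim_col B" C "dim_col C"];
      rule carrier_matI; simp add: assms)

lemma transpose_mult_dim:
  fixes A B :: "'a :: comm_ring_1 mat"
  assumes "dim_col A = dim_row B"
  shows "(A * B)\<^sup>T = B\<^sup>T * A\<^sup>T"
  by (rule transpose_mult[of A "dim_row A" "dim_row B" B "dim_col B"];
      rule carrier_matI; simp add: assms)

lemma minus_mult_dim:
  fixes A B C :: "'a :: comm_ring_1 mat"
  assumes "dim_col A = dim_row C" "dim_row B = dim_row A" "dim_col B = dim_col A"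
  shows "(A - B) * C = A * C - B * C"
  by (rule minus_mult_distrib_mat[of A "dim_row A" "dim_col A" B C "dim_col C"];
      rule carrier_matI; simp add: assms)

lemma mult_minus_dim:
  fixes A B C :: "'a :: comm_ring_1 mat"
  assumes "dim_col A = dim_row B" "dim_row C = dim_row B" "dim_col C = dim_col B"
  shows "A * (B - C) = A * B - A * C"
  by (rule mult_minus_distrib_mat[of A "dim_row A" "dim_col A" B "dim_col B" C];
      rule carrier_matI; simp add: assms)

lemma mat_mult_index:
  assumes "i < dim_row A" "j < dim_col B" "dim_col A = dim_row B"
  shows "(A * B) $$ (i, j) = (\<Sum>k<dim_row B. A $$ (i, k) * B $$ (k, j))"
  using assms by (simp add: scalar_prod_def atLeast0LessThan)

text \<open>
The trace, meant for square matrices.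
\<close>
definition tr :: "real mat \<Rightarrow> real" where
  "tr A = (\<Sum>i<dim_row A. A $$ (i, i))"

lemma tr_comm:
  assumes "dim_col A = dim_row B" "dim_col B = dim_row A"
  shows "tr (A * B) = tr (B * A)"
proof -
  have "tr (A * B) = (\<Sum>i<dim_row A. \<Sum>k<dim_row B. A $$ (i, k) * B $$ (k, i))"
    unfolding tr_def using assms by (simp add: mat_mult_index del: index_mult_mat(1))
  also have "\<dots> = (\<Sum>k<dim_row B. \<Sum>i<dim_row A. B $$ (k, i) * A $$ (i, k))"
    by (subst sum.swap) (simp add: mult.commute)
  also have "\<dots> = tr (B * A)"
    unfolding tr_def using assms by (simp add: mat_mult_index del: index_mult_mat(1))
  finally show ?thesis .
qed

lemma tr_minus:
  assumes "dim_row A = dim_row B" "dim_col A = dim_row A" "dim_col B = dim_row B"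
  shows "tr (A - B) = tr A - tr B"
  using assms by (simp add: tr_def sum_subtractf)

text \<open>
The square of the Frobenius norm.
\<close>
definition fnorm2 :: "real mat \<Rightarrow> real" where
  "fnorm2 A = (\<Sum>i<dim_row A. \<Sum>j<dim_col A. (A $$ (i, j))\<^sup>2)"

lemma fnorm2_nonneg: "fnorm2 A \<ge> 0"
  by (simp add: fnorm2_def sum_nonneg)

lemma fnorm2_tr: "fnorm2 A = tr (A\<^sup>T * A)"
proof -
  have "tr (A\<^sup>T * A) = (\<Sum>j<dim_col A. \<Sum>i<dim_row A. (A $$ (i, j))\<^sup>2)"
    unfolding tr_def by (simp add: mat_mult_index power2_eq_square del: index_mult_mat(1))
  then show ?thesis unfolding fnorm2_def by (subst sum.swap) simp
qed

lemma fnorm2_transpose: "fnorm2 (A\<^sup>T) = fnorm2 A"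
  unfolding fnorm2_def by (subst sum.swap) simp

text \<open>
A column as a matrix with one column, so that vectors and matrices share the facts on \<open>fnorm2\<close>.
\<close>
definition col_mat :: "'a mat \<Rightarrow> nat \<Rightarrow> 'a mat" where
  "col_mat X k = mat (dim_row X) 1 (\<lambda>(i, _). X $$ (i, k))"

lemma col_mat_mult:
  assumes "k < dim_col X" "i < dim_row Q" "dim_col Q = dim_row X"
  shows "(Q * X) $$ (i, k) = (Q * col_mat X k) $$ (i, 0)"
  using assms by (subst (1 2) mat_mult_index) (simp_all add: col_mat_def)

lemma fnorm2_col_mat:
  assumes "k < dim_col X"
  shows "fnorm2 (col_mat X k) = (X\<^sup>T * X) $$ (k, k)"
  using assms by (subst mat_mult_index) (simp_all add: fnorm2_def col_mat_def power2_eq_square)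

section \<open>The spectral theorem for real symmetric matrices\<close>

lemma symmetric_real_eigenvector:
  fixes S :: "real mat"
  assumes S: "S \<in> carrier_mat n n" and sym: "S\<^sup>T = S" and n: "n > 0"
  shows "\<exists>a v. v \<in> carrier_vec n \<and> v \<bullet> v = 1 \<and> S *\<^sub>v v = a \<cdot>\<^sub>v v"
proof -
  define C where "C = map_mat complex_of_real S"
  have C: "C \<in> carrier_mat n n" using S by (simp add: C_def)
  have "degree (char_poly C) > 0" using degree_monic_char_poly[OF C] n by simp
  then have "\<not> constant (poly (char_poly C))" by (simp add: constant_degree)
  then obtain z where "poly (char_poly C) z = 0"
    using fundamental_theorem_of_algebra by blast
  then have "eigenvalue C z" using eigenvalue_root_char_poly[OF C] by simp
  then obtain w where w: "w \<in> carrier_vec n" "w \<noteq> 0\<^sub>v n" "C *\<^sub>v w = z \<cdot>\<^sub>v w"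
    using C unfolding eigenvalue_def eigenvector_def by auto
  define x where "x = map_vec Re w"
  define y where "y = map_vec Im w"
  have x: "x \<in> carrier_vec n" and y: "y \<in> carrier_vec n" using w by (auto simp: x_def y_def)
  have entry: "(\<Sum>k<n. complex_of_real (S $$ (i, k)) * w $ k) = z * w $ i" if "i < n" for i
    using arg_cong[OF w(3), of "\<lambda>u. u $ i"] that S w(1)
    by (simp add: C_def scalar_prod_def atLeast0LessThan)
  \<comment> \<open>Split the complex eigenvector into real and imaginary part; symmetry forces the eigenvalue
    to be real, so both parts are real eigenvectors and at least one of them is nonzero.\<close>
  have Sx: "S *\<^sub>v x = Re z \<cdot>\<^sub>v x - Im z \<cdot>\<^sub>v y"
    using S w(1) arg_cong[OF entry, of _ Re]
    by (auto simp: x_def y_def scalar_prod_def atLeast0LessThan intro!: eq_vecI)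
  have Sy: "S *\<^sub>v y = Re z \<cdot>\<^sub>v y + Im z \<cdot>\<^sub>v x"
    using S w(1) arg_cong[OF entry, of _ Im]
    by (auto simp: x_def y_def scalar_prod_def atLeast0LessThan intro!: eq_vecI)
  have nonzero: "x \<noteq> 0\<^sub>v n \<or> y \<noteq> 0\<^sub>v n"
  proof (rule ccontr)
    assume "\<not> ?thesis"
    then have x0: "x = 0\<^sub>v n" and y0: "y = 0\<^sub>v n" by auto
    have "w = 0\<^sub>v n"
    proof (rule eq_vecI)
      fix i assume i: "i < dim_vec (0\<^sub>v n :: complex vec)"
      then have "x $ i = 0" "y $ i = 0" using x0 y0 by auto
      then show "w $ i = 0\<^sub>v n $ i" using i w(1) by (auto simp: x_def y_def complex_eq_iff)
    qed (use w in auto)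
    with w(2) show False by simp
  qed
  have pos: "x \<bullet> x + y \<bullet> y > 0"
  proof -
    have sq: "u \<bullet> u \<ge> 0 \<and> (u \<bullet> u = 0 \<longrightarrow> u = 0\<^sub>v n)" if "u \<in> carrier_vec n" for u :: "real vec"
      using that conjugate_square_eq_0_vec[OF that] conjugate_square_ge_0_vec[of u]
      by (simp add: conjugate_vec_def vec_eq_iff)
    show ?thesis using sq[OF x] sq[OF y] nonzero by (smt (verit))
  qed
  have "(S *\<^sub>v x) \<bullet> y = x \<bullet> (S *\<^sub>v y)"
    using transpose_vec_mult_scalar[OF S x y] sym S x y
      comm_scalar_prod[of "S *\<^sub>v x" n y] comm_scalar_prod[of "S *\<^sub>v y" n x]
    by (simp add: mult_mat_vec_carrier[OF S])
  then have "Re z * (x \<bullet> y) - Im z * (y \<bullet> y) = Re z * (x \<bullet> y) + Im z * (x \<bullet> x)"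
    unfolding Sx Sy using x y
    by (simp add: minus_scalar_prod_distrib[of _ n] scalar_prod_add_distrib[of _ n])
  then have "Im z * (x \<bullet> x + y \<bullet> y) = 0" by (simp add: algebra_simps)
  then have Im0: "Im z = 0" using pos by simp
  have "S *\<^sub>v x = Re z \<cdot>\<^sub>v x" "S *\<^sub>v y = Re z \<cdot>\<^sub>v y"
    unfolding Sx Sy Im0 using x y by (auto intro!: eq_vecI)
  then obtain u where u: "u \<in> carrier_vec n" "u \<bullet> u > 0" "S *\<^sub>v u = Re z \<cdot>\<^sub>v u"
    using x y pos by (cases "x \<bullet> x > 0") auto
  define v where "v = (1 / sqrt (u \<bullet> u)) \<cdot>\<^sub>v u"
  have "v \<in> carrier_vec n" using u by (simp add: v_def)
  moreover have "v \<bullet> v = 1" using u by (simp add: v_def)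
  moreover have "S *\<^sub>v v = Re z \<cdot>\<^sub>v v"
    using u S by (simp add: v_def mult_mat_vec[of _ n n] smult_smult_assoc mult.commute)
  ultimately show ?thesis by blast
qed

text \<open>
An orthogonal symmetric matrix with a prescribed unit vector as first column.
\<close>
lemma householder:
  fixes v :: "real vec"
  assumes v: "v \<in> carrier_vec n" "v \<bullet> v = 1" and n: "n > 0"
  shows "\<exists>H \<in> carrier_mat n n. H\<^sup>T = H \<and> H * H = 1\<^sub>m n \<and> col H 0 = v"
proof (cases "v $ 0 = 1")
  case True
  have "(\<Sum>i<n. v $ i * v $ i) = 1" using v by (simp add: scalar_prod_def atLeast0LessThan)
  then have "(\<Sum>i\<in>{..<n}-{0}. v $ i * v $ i) = 0"
    using True n by (simp add: sum.remove[of "{..<n}" 0])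
  then have "v $ i = 0" if "i < n" "i \<noteq> 0" for i
    using that by (subst (asm) sum_nonneg_eq_0_iff) auto
  then have "col (1\<^sub>m n) 0 = v" using v n True by (auto intro!: eq_vecI)
  then show ?thesis by (intro bexI[of _ "1\<^sub>m n"]) auto
next
  case False
  \<comment> \<open>\<open>H\<close> is the reflection in the hyperplane orthogonal to \<open>w = e\<^sub>0 - v\<close>; since \<open>v\<close> is a unit
    vector, \<open>w \<bullet> w = 2 * (1 - v $ 0)\<close>, which is where the constant \<open>c = 2 / (w \<bullet> w)\<close> comes from.\<close>
  define w where "w i = (if i = 0 then 1 else 0) - v $ i" for i
  define c where "c = 1 / (1 - v $ 0)"
  have vv: "(\<Sum>i<n. v $ i * v $ i) = 1" using v by (simp add: scalar_prod_def atLeast0LessThan)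
  have "(\<Sum>i<n. w i * w i) = (\<Sum>i<n. (if i = 0 then 1 - 2 * v $ 0 else 0) + v $ i * v $ i)"
    by (rule sum.cong) (auto simp: w_def algebra_simps)
  also have "\<dots> = 2 * (1 - v $ 0)" using n vv by (simp add: sum.distrib)
  finally have ww: "c * (\<Sum>i<n. w i * w i) = 2" using False by (simp add: c_def field_simps)
  define H where "H = mat n n (\<lambda>(i, j). (if i = j then 1 else 0) - c * w i * w j)"
  have H: "H \<in> carrier_mat n n" by (simp add: H_def)
  have "H\<^sup>T = H" by (rule eq_matI) (auto simp: H_def)
  moreover have "H * H = 1\<^sub>m n"
  proof (rule eq_matI)
    fix i j assume "i < dim_row (1\<^sub>m n :: real mat)" "j < dim_col (1\<^sub>m n :: real mat)"
    then have ij: "i < n" "j < n" by auto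
    have "(H * H) $$ (i, j) = (\<Sum>k<n. ((if i = k then 1 else 0) - c * w i * w k) *
        ((if k = j then 1 else 0) - c * w k * w j))"
      using ij H by (simp add: mat_mult_index H_def del: index_mult_mat(1))
    also have "\<dots> = (\<Sum>k<n. (if k = i then (if i = j then 1 else 0) else 0)
        - (if k = i then c * w i * w j else 0) - (if k = j then c * w i * w j else 0)
        + c * c * w i * w j * (w k * w k))"
      by (rule sum.cong) (auto simp: algebra_simps)
    also have "\<dots> = (if i = j then 1 else 0) - 2 * c * w i * w j
        + c * w i * w j * (c * (\<Sum>k<n. w k * w k))"
      using ij by (simp add: sum.distrib sum_subtractf sum_distrib_left algebra_simps)
    also have "\<dots> = 1\<^sub>m n $$ (i, j)" unfolding ww using ij by simp
    finally show "(H * H) $$ (i, j) = 1\<^sub>m n $$ (i, j)" .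
  qed (use H in auto)
  moreover have "col H 0 = v"
  proof (rule eq_vecI)
    fix i assume "i < dim_vec v"
    then have i: "i < n" using v by auto
    have "c * w 0 = 1" using False by (simp add: c_def w_def)
    then have "c * w i * w 0 = (if i = 0 then 1 else 0) - v $ i"
      unfolding w_def[of i, symmetric] by (metis mult.commute mult.assoc mult_1)
    moreover have "col H 0 $ i = (if i = 0 then 1 else 0) - c * w i * w 0"
      using i n by (simp add: H_def)
    ultimately show "col H 0 $ i = v $ i" by simp
  qed (use v H in auto)
  ultimately show ?thesis using H by blast
qed

lemma block_diag_mult:
  fixes A B :: "'a :: comm_ring_1 mat"
  assumes "a \<in> carrier_mat 1 1" "b \<in> carrier_mat 1 1" "A \<in> carrier_mat n n" "B \<in> carrier_mat n n"
  shows "four_block_mat a (0\<^sub>m 1 n) (0\<^sub>m n 1) A * four_block_mat b (0\<^sub>m 1 n) (0\<^sub>m n 1) B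
    = four_block_mat (a * b) (0\<^sub>m 1 n) (0\<^sub>m n 1) (A * B)"
proof -
  have "0\<^sub>m 1 n * B = 0\<^sub>m 1 n" "a * 0\<^sub>m 1 n = 0\<^sub>m 1 n" "0\<^sub>m n 1 * b = 0\<^sub>m n 1" "A * 0\<^sub>m n 1 = 0\<^sub>m n 1"
    "0\<^sub>m 1 n * 0\<^sub>m n 1 = (0\<^sub>m 1 1 :: 'a mat)" "0\<^sub>m n 1 * 0\<^sub>m 1 n = (0\<^sub>m n n :: 'a mat)"
    "a * b + 0\<^sub>m 1 1 = a * b" "0\<^sub>m n n + A * B = A * B"
    "0\<^sub>m 1 n + 0\<^sub>m 1 n = (0\<^sub>m 1 n :: 'a mat)" "0\<^sub>m n 1 + 0\<^sub>m n 1 = (0\<^sub>m n 1 :: 'a mat)"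
    using assms by (auto intro!: right_add_zero_mat left_add_zero_mat)
  then show ?thesis
    by (subst mult_four_block_mat[OF assms(1) zero_carrier_mat zero_carrier_mat assms(3)
          assms(2) zero_carrier_mat zero_carrier_mat assms(4)]) (simp only:)
qed

theorem real_spectral:
  fixes S :: "real mat"
  assumes "S \<in> carrier_mat n n" and "S\<^sup>T = S"
  shows "\<exists>U d. U \<in> carrier_mat n n \<and> U\<^sup>T * U = 1\<^sub>m n \<and> S = U * mat_diag n d * U\<^sup>T"
  using assms
proof (induction n arbitrary: S)
  case 0
  then show ?case by (intro exI[of _ "1\<^sub>m 0"] exI[of _ "\<lambda>_. 0"]) auto
next
  case (Suc n)
  obtain a v where v: "v \<in> carrier_vec (Suc n)" "v \<bullet> v = 1" and Sv: "S *\<^sub>v v = a \<cdot>\<^sub>v v"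
    using symmetric_real_eigenvector[OF Suc.prems] by auto
  obtain H where H: "H \<in> carrier_mat (Suc n) (Suc n)" and HT: "H\<^sup>T = H"
    and HH: "H * H = 1\<^sub>m (Suc n)" and Hv: "col H 0 = v"
    using householder[OF v] by auto
  \<comment> \<open>\<open>H\<close> sends \<open>e\<^sub>0\<close> to an eigenvector, so \<open>B\<close> has first column \<open>a e\<^sub>0\<close>, and by symmetry first
    row \<open>a e\<^sub>0\<^sup>T\<close>. The induction hypothesis diagonalises the remaining block.\<close>
  define B where "B = H * S * H"
  have S: "dim_row S = Suc n" "dim_col S = Suc n" and H': "dim_row H = Suc n" "dim_col H = Suc n"
    using Suc.prems(1) H by auto
  have B: "B \<in> carrier_mat (Suc n) (Suc n)" using S H' by (auto simp: B_def)
  have BT: "B\<^sup>T = B"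
    unfolding B_def using S H' HT Suc.prems(2) by (simp add: transpose_mult_dim mat_assoc)
  have SB: "S = H * B * H"
  proof -
    have "H * B * H = (H * H) * S * (H * H)"
      unfolding B_def using S H' by (simp add: mat_assoc del: assoc_mult_mat)
    then show ?thesis unfolding HH using Suc.prems(1) by simp
  qed
  have "col B 0 = H *\<^sub>v (S *\<^sub>v col H 0)"
    unfolding B_def col_mult2[OF mult_carrier_mat[OF H Suc.prems(1)] H zero_less_Suc]
    using H by (intro assoc_mult_mat_vec[OF H Suc.prems(1)] carrier_vecI) auto
  also have "\<dots> = a \<cdot>\<^sub>v (H *\<^sub>v col H 0)" unfolding Hv Sv using H v by (simp add: mult_mat_vec)
  also have "H *\<^sub>v col H 0 = col (H * H) 0" using H by (subst col_mult2[of _ "Suc n" "Suc n"]) auto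
  also have "\<dots> = unit_vec (Suc n) 0" unfolding HH by simp
  finally have colB: "col B 0 = a \<cdot>\<^sub>v unit_vec (Suc n) 0" .
  have col0: "B $$ (i, 0) = (if i = 0 then a else 0)" if "i < Suc n" for i
  proof -
    have "B $$ (i, 0) = col B 0 $ i" using that B by simp
    then show ?thesis unfolding colB using that by simp
  qed
  have row0: "B $$ (0, i) = (if i = 0 then a else 0)" if "i < Suc n" for i
    using col0[OF that] BT that B by (metis carrier_matD index_transpose_mat(1) zero_less_Suc)
  define S' where "S' = mat n n (\<lambda>(i, j). B $$ (Suc i, Suc j))"
  have "S'\<^sup>T = S'"
  proof (rule eq_matI)
    fix i j assume "i < dim_row S'" "j < dim_col S'"
    then show "S'\<^sup>T $$ (i, j) = S' $$ (i, j)"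
      using arg_cong[OF BT, of "\<lambda>M. M $$ (Suc i, Suc j)"] B by (simp add: S'_def)
  qed (auto simp: S'_def)
  then obtain U d where U: "U \<in> carrier_mat n n" "U\<^sup>T * U = 1\<^sub>m n"
    and S'U: "S' = U * mat_diag n d * U\<^sup>T"
    using Suc.IH[of S'] by (auto simp: S'_def)
  define P where "P = four_block_mat (1\<^sub>m 1) (0\<^sub>m 1 n) (0\<^sub>m n 1) U"
  define e where "e i = (case i of 0 \<Rightarrow> a | Suc j \<Rightarrow> d j)" for i
  have P: "P \<in> carrier_mat (Suc n) (Suc n)"
    unfolding P_def using U four_block_carrier_mat[of "1\<^sub>m 1" 1 1 U n n] by simp
  have PT: "P\<^sup>T = four_block_mat (1\<^sub>m 1) (0\<^sub>m 1 n) (0\<^sub>m n 1) U\<^sup>T"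
    unfolding P_def using U by (subst transpose_four_block_mat[of _ 1 1 _ n _ n]) auto
  have De: "mat_diag (Suc n) e = four_block_mat (a \<cdot>\<^sub>m 1\<^sub>m 1) (0\<^sub>m 1 n) (0\<^sub>m n 1) (mat_diag n d)"
    by (rule eq_matI) (auto simp: mat_diag_def e_def split: nat.splits)
  have "P\<^sup>T * P = four_block_mat (1\<^sub>m 1 * 1\<^sub>m 1) (0\<^sub>m 1 n) (0\<^sub>m n 1) (U\<^sup>T * U)"
    unfolding PT unfolding P_def using U by (intro block_diag_mult) auto
  then have PTP: "P\<^sup>T * P = 1\<^sub>m (Suc n)" unfolding U by simp
  have "P * mat_diag (Suc n) e * P\<^sup>T
      = four_block_mat (1\<^sub>m 1 * (a \<cdot>\<^sub>m 1\<^sub>m 1) * 1\<^sub>m 1) (0\<^sub>m 1 n) (0\<^sub>m n 1) S'"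
  proof -
    have "P * mat_diag (Suc n) e
        = four_block_mat (1\<^sub>m 1 * (a \<cdot>\<^sub>m 1\<^sub>m 1)) (0\<^sub>m 1 n) (0\<^sub>m n 1) (U * mat_diag n d)"
      unfolding De P_def using U by (intro block_diag_mult) auto
    then show ?thesis unfolding PT S'U using U
      by (simp only:) (intro block_diag_mult; auto)
  qed
  also have "1\<^sub>m 1 * (a \<cdot>\<^sub>m 1\<^sub>m 1) * 1\<^sub>m 1 = a \<cdot>\<^sub>m (1\<^sub>m 1 :: real mat)" by simp
  also have "four_block_mat (a \<cdot>\<^sub>m 1\<^sub>m 1) (0\<^sub>m 1 n) (0\<^sub>m n 1) S' = B"
    using B col0 row0 by (intro eq_matI) (auto simp: S'_def)
  finally have PB: "P * mat_diag (Suc n) e * P\<^sup>T = B" .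
  define W where "W = H * P"
  have P': "dim_row P = Suc n" "dim_col P = Suc n" using P by auto
  have D': "dim_row (mat_diag (Suc n) e) = Suc n" "dim_col (mat_diag (Suc n) e) = Suc n"
    by (auto simp: mat_diag_def)
  have WT: "W\<^sup>T = P\<^sup>T * H" unfolding W_def using H' P' HT by (simp add: transpose_mult_dim)
  have "W\<^sup>T * W = P\<^sup>T * (H * H) * P"
    unfolding WT unfolding W_def using H' P' by (simp add: mat_assoc)
  then have "W\<^sup>T * W = 1\<^sub>m (Suc n)" unfolding HH using PTP P by simp
  moreover have "W * mat_diag (Suc n) e * W\<^sup>T = H * (P * mat_diag (Suc n) e * P\<^sup>T) * H"
    unfolding WT unfolding W_def using H' P' D' by (simp add: mat_assoc)
  then have "S = W * mat_diag (Suc n) e * W\<^sup>T" unfolding PB SB[symmetric] by simp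
  moreover have "W \<in> carrier_mat (Suc n) (Suc n)" using H P by (simp add: W_def)
  ultimately show ?case by blast
qed

lemma tr_conj_diag:
  assumes "V \<in> carrier_mat n n" "N \<in> carrier_mat n n"
  shows "tr (N * (V * mat_diag n d * V\<^sup>T)) = (\<Sum>k<n. d k * (V\<^sup>T * N * V) $$ (k, k))"
proof -
  have c: "dim_row V = n" "dim_col V = n" "dim_row N = n" "dim_col N = n"
    "dim_row (mat_diag n d) = n" "dim_col (mat_diag n d) = n"
    using assms by (auto simp: mat_diag_def)
  have "N * (V * mat_diag n d * V\<^sup>T) = (N * V) * (mat_diag n d * V\<^sup>T)"
    using c by (simp add: mat_assoc)
  then have "tr (N * (V * mat_diag n d * V\<^sup>T)) = tr ((mat_diag n d * V\<^sup>T) * (N * V))"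
    using c by (simp add: tr_comm)
  also have "(mat_diag n d * V\<^sup>T) * (N * V) = mat_diag n d * (V\<^sup>T * N * V)"
    using c by (simp add: mat_assoc)
  also have "\<dots> = mat n n (\<lambda>(i, j). d i * (V\<^sup>T * N * V) $$ (i, j))"
    using assms by (intro mat_diag_mult_left) auto
  finally show ?thesis by (simp add: tr_def)
qed

lemma gram_eigenvalue_nonneg:
  fixes X :: "real mat"
  assumes "X\<^sup>T * X = V * mat_diag n d * V\<^sup>T" "V\<^sup>T * V = 1\<^sub>m n" "V \<in> carrier_mat n n" "k < n"
  shows "0 \<le> d k"
proof -
  have c: "dim_row V = n" "dim_col V = n" "dim_row (mat_diag n d) = n" "dim_col (mat_diag n d) = n"
    using assms(3) by (auto simp: mat_diag_def)
  have X: "dim_col X = n" using arg_cong[OF assms(1), of dim_row] c by simp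
  have "(X * V)\<^sup>T * (X * V) = V\<^sup>T * (X\<^sup>T * X) * V"
    using c X by (simp add: transpose_mult_dim mat_assoc)
  also have "\<dots> = (V\<^sup>T * V) * mat_diag n d * (V\<^sup>T * V)"
    unfolding assms(1) using c by (simp add: mat_assoc)
  also have "\<dots> = mat_diag n d" unfolding assms(2) by (simp add: mat_diag_def)
  finally have "d k = ((X * V)\<^sup>T * (X * V)) $$ (k, k)" using assms(4) by (simp add: mat_diag_def)
  also have "\<dots> = (\<Sum>i<dim_row X. ((X * V) $$ (i, k))\<^sup>2)"
    using assms(4) c by (subst mat_mult_index) (simp_all add: power2_eq_square del: index_mult_mat(1))
  also have "\<dots> \<ge> 0" by (rule sum_nonneg) simp
  finally show ?thesis .
qed

section \<open>Orthogonal projections\<close>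

lemma gram_diag_col_zero:
  fixes X :: "real mat"
  assumes "X\<^sup>T * X = mat_diag n d" "d k = 0" "k < dim_col X" "i < dim_row X" "n = dim_col X"
  shows "X $$ (i, k) = 0"
proof -
  have "(\<Sum>i<dim_row X. (X $$ (i, k))\<^sup>2) = (X\<^sup>T * X) $$ (k, k)"
    using assms(3) by (simp add: mat_mult_index power2_eq_square del: index_mult_mat(1))
  also have "\<dots> = 0" using assms by (simp add: mat_diag_def)
  finally have "\<forall>i\<in>{..<dim_row X}. (X $$ (i, k))\<^sup>2 = 0"
    by (subst (asm) sum_nonneg_eq_0_iff) auto
  then show ?thesis using assms by simp
qed

text \<open>
The orthogonal projection \<open>Q\<close> onto the complement of the column space of \<open>W\<close>. The matrix \<open>G\<close>
computes least-squares coefficients: \<open>W * (G * x)\<close> is the point of the column space nearest to \<open>x\<close>.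
The trace of \<open>Q\<close> is the dimension of the complement, hence the lower bound.
\<close>
lemma residual_projection:
  fixes W :: "real mat"
  assumes W: "W \<in> carrier_mat n r"
  shows "\<exists>Q G. Q \<in> carrier_mat n n \<and> G \<in> carrier_mat r n \<and> Q = 1\<^sub>m n - W * G
    \<and> Q\<^sup>T = Q \<and> Q * Q = Q \<and> Q * W = 0\<^sub>m n r \<and> tr Q \<ge> real n - real r"
proof -
  have "W\<^sup>T * W \<in> carrier_mat r r" "(W\<^sup>T * W)\<^sup>T = W\<^sup>T * W"
    using W by (auto simp: transpose_mult_dim)
  from real_spectral[OF this] obtain U d where U: "U \<in> carrier_mat r r" "U\<^sup>T * U = 1\<^sub>m r"
    and WU: "W\<^sup>T * W = U * mat_diag r d * U\<^sup>T" by blast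
  have UU: "U * U\<^sup>T = 1\<^sub>m r" using mat_mult_left_right_inverse[of "U\<^sup>T" r U] U by simp
  \<comment> \<open>\<open>E\<close> is the pseudo-inverse of the diagonal matrix \<open>D\<close>, and \<open>G\<close> that of \<open>W\<close>.\<close>
  define D E where "D = mat_diag r d" and "E = mat_diag r (\<lambda>i. if d i = 0 then 0 else 1 / d i)"
  define F where "F = mat_diag r (\<lambda>i. if d i = 0 then 0 else (1 :: real))"
  have ED: "E * D = F" unfolding E_def D_def F_def mat_diag_diag
    by (rule arg_cong[where f = "mat_diag r"]) auto
  have ET: "E\<^sup>T = E" by (rule eq_matI) (auto simp: E_def mat_diag_def)
  have c: "dim_row W = n" "dim_col W = r" "dim_row U = r" "dim_col U = r"
    "dim_row D = r" "dim_col D = r" "dim_row E = r" "dim_col E = r" "dim_row F = r" "dim_col F = r"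
    using W U by (auto simp: D_def E_def F_def mat_diag_def)
  define G where "G = U * E * U\<^sup>T * W\<^sup>T"
  define Q where "Q = 1\<^sub>m n - W * G"
  have cG: "dim_row G = r" "dim_col G = n" using c by (auto simp: G_def)
  have cQ: "dim_row Q = n" "dim_col Q = n" using c cG by (auto simp: Q_def)
  have "G * W = U * E * U\<^sup>T * (W\<^sup>T * W)" unfolding G_def using c by (simp add: mat_assoc)
  also have "\<dots> = U * E * (U\<^sup>T * U) * D * U\<^sup>T" unfolding WU D_def[symmetric]
    using c by (simp add: mat_assoc)
  also have "\<dots> = U * (E * D) * U\<^sup>T" unfolding U(2) using c
    by (simp add: mat_assoc right_mult_one_mat' left_mult_one_mat')
  finally have GW: "G * W = U * F * U\<^sup>T" unfolding ED .
  have "(W * U)\<^sup>T * (W * U) = U\<^sup>T * (W\<^sup>T * W) * U"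
    using c by (simp add: mat_assoc transpose_mult_dim)
  also have "\<dots> = (U\<^sup>T * U) * D * (U\<^sup>T * U)" unfolding WU D_def[symmetric]
    using c by (simp add: mat_assoc)
  also have "\<dots> = mat_diag r d" unfolding U(2) D_def by (simp add: mat_diag_def)
  finally have gram: "(W * U)\<^sup>T * (W * U) = mat_diag r d" .
  \<comment> \<open>A column of \<open>W * U\<close> that \<open>F\<close> erases belongs to \<open>d j = 0\<close> and hence has norm zero.\<close>
  have "W * U * F = W * U"
  proof -
    have "W * U * F = mat n r (\<lambda>(i, j). (W * U) $$ (i, j) * (if d j = 0 then 0 else 1))"
      unfolding F_def using W U by (intro mat_diag_mult_right) auto
    also have "\<dots> = W * U"
    proof (rule eq_matI)
      fix i j assume ij: "i < dim_row (W * U)" "j < dim_col (W * U)"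
      then have "(W * U) $$ (i, j) = 0" if "d j = 0"
        using that c by (intro gram_diag_col_zero[OF gram]) simp_all
      then show "mat n r (\<lambda>(i, j). (W * U) $$ (i, j) * (if d j = 0 then 0 else 1)) $$ (i, j)
          = (W * U) $$ (i, j)" using ij c by (simp del: index_mult_mat(1))
    qed (use c in simp_all)
    finally show ?thesis .
  qed
  moreover have "W * (G * W) = W * U * F * U\<^sup>T" unfolding GW using c by (simp add: mat_assoc)
  ultimately have "W * (G * W) = W * U * U\<^sup>T" by simp
  also have "\<dots> = W" using c UU W by (simp add: mat_assoc)
  finally have WGW: "W * (G * W) = W" .
  have QW: "Q * W = 0\<^sub>m n r"
    unfolding Q_def using c cG WGW W by (simp add: minus_mult_dim mat_assoc)
  have "(W * G)\<^sup>T = W * G"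
    unfolding G_def using c ET by (simp add: transpose_mult_dim mat_assoc)
  then have QT: "Q\<^sup>T = Q" unfolding Q_def using c cG
    by (subst transpose_minus[of _ n n]) auto
  have "Q * Q = Q * 1\<^sub>m n - Q * (W * G)"
    using c cG cQ by (subst (2) Q_def) (simp add: mult_minus_dim)
  also have "Q * (W * G) = 0\<^sub>m n n"
    using QW c cG cQ mat_assoc[of Q W G] by (simp add: left_mult_zero_mat')
  finally have QQ: "Q * Q = Q" using cQ by (simp add: right_mult_one_mat') (auto intro!: eq_matI)
  \<comment> \<open>The trace of \<open>W * G\<close> counts the nonzero eigenvalues of \<open>W\<^sup>T * W\<close>.\<close>
  have "tr (W * G) = tr (U * F * U\<^sup>T)" using c cG by (simp add: tr_comm flip: GW)
  also have "\<dots> = tr (U\<^sup>T * (U * F))" using c by (simp add: tr_comm)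
  also have "U\<^sup>T * (U * F) = F" using c U mat_assoc[of "U\<^sup>T" U F] by (simp add: left_mult_one_mat')
  also have "tr F = (\<Sum>i<r. if d i = 0 then 0 else 1)"
    unfolding tr_def using c by (simp add: F_def mat_diag_def)
  also have "\<dots> \<le> (\<Sum>i<r. 1)" by (rule sum_mono) auto
  finally have "tr (W * G) \<le> real r" by simp
  moreover have "tr Q = tr (1\<^sub>m n) - tr (W * G)" unfolding Q_def using c cG by (simp add: tr_minus)
  moreover have "tr (1\<^sub>m n) = real n" by (simp add: tr_def)
  ultimately have "tr Q \<ge> real n - real r" by simp
  then show ?thesis using QT QQ QW Q_def cG cQ
    by (intro exI[of _ Q] exI[of _ G]) (auto intro!: carrier_matI)
qed

lemma fnorm2_projection_tr:
  assumes "Q\<^sup>T = Q" "Q * Q = Q" "dim_row X = dim_row Q"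
  shows "fnorm2 (Q * X) = tr (Q * (X * X\<^sup>T))"
proof -
  have sq: "dim_col Q = dim_row Q" using assms(1) by (metis index_transpose_mat(2))
  have "fnorm2 (Q * X) = tr (X\<^sup>T * (Q * Q) * X)"
    using assms(1,3) sq by (simp add: fnorm2_tr transpose_mult_dim mat_assoc)
  also have "\<dots> = tr ((X\<^sup>T * Q) * X)" unfolding assms(2) ..
  also have "\<dots> = tr (X * (X\<^sup>T * Q))" using assms sq by (simp add: tr_comm)
  also have "\<dots> = tr ((X * X\<^sup>T) * Q)" using assms sq by (simp add: mat_assoc)
  also have "\<dots> = tr (Q * (X * X\<^sup>T))" using assms sq by (simp add: tr_comm)
  finally show ?thesis .
qed

lemma fnorm2_minus_projection:
  assumes Q: "Q\<^sup>T = Q" "Q * Q = Q" and d: "dim_row X = dim_row Q"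
  shows "fnorm2 (X - Q * X) = fnorm2 X - fnorm2 (Q * X)"
proof -
  have sq: "dim_col Q = dim_row Q" using Q(1) by (metis index_transpose_mat(2))
  have T: "(X - Q * X)\<^sup>T = X\<^sup>T - X\<^sup>T * Q"
  proof -
    have "(X - Q * X)\<^sup>T = X\<^sup>T - (Q * X)\<^sup>T"
      by (rule transpose_minus[of _ "dim_row X" "dim_col X"]; rule carrier_matI; simp add: d)
    then show ?thesis using sq d by (simp add: transpose_mult_dim Q(1))
  qed
  have QX: "Q * (Q * X) = Q * X" using Q sq d mat_assoc[of Q Q X] by simp
  have z: "X\<^sup>T * Q * (X - Q * X) = 0\<^sub>m (dim_col X) (dim_col X)"
  proof -
    have "X\<^sup>T * Q * (X - Q * X) = X\<^sup>T * (Q * X) - X\<^sup>T * (Q * X)"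
      using sq d QX by (simp add: mult_minus_dim mat_assoc)
    also have "\<dots> = 0\<^sub>m (dim_col X) (dim_col X)"
      by (intro eq_matI) (simp_all del: index_mult_mat(1))
    finally show ?thesis .
  qed
  have "(X - Q * X)\<^sup>T * (X - Q * X) = X\<^sup>T * (X - Q * X) - X\<^sup>T * Q * (X - Q * X)"
    unfolding T using sq d by (simp add: minus_mult_dim)
  also have "\<dots> = X\<^sup>T * (X - Q * X)"
    unfolding z using d sq by (intro eq_matI) (auto simp del: index_mult_mat(1))
  also have "\<dots> = X\<^sup>T * X - X\<^sup>T * (Q * X)" using sq d by (simp add: mult_minus_dim)
  finally have "fnorm2 (X - Q * X) = tr (X\<^sup>T * X) - tr (X\<^sup>T * (Q * X))"
    using sq d by (simp add: fnorm2_tr tr_minus)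
  also have "X\<^sup>T * (Q * X) = (Q * X)\<^sup>T * (Q * X)"
    using sq d Q QX by (simp add: transpose_mult_dim mat_assoc)
  finally show ?thesis by (simp add: fnorm2_tr)
qed

lemma fnorm2_projection_le:
  assumes "Q\<^sup>T = Q" "Q * Q = Q" "dim_row X = dim_row Q"
  shows "fnorm2 (Q * X) \<le> fnorm2 X"
  using fnorm2_minus_projection[OF assms] fnorm2_nonneg[of "X - Q * X"] by simp

lemma projection_diag_entry:
  assumes Q: "Q\<^sup>T = Q" "Q * Q = Q" and d: "dim_row X = dim_row Q" and k: "k < dim_col X"
  shows "(X\<^sup>T * Q * X) $$ (k, k) = fnorm2 (Q * col_mat X k)"
proof -
  have sq: "dim_col Q = dim_row Q" using Q(1) by (metis index_transpose_mat(2))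
  have "(Q * X)\<^sup>T * (Q * X) = X\<^sup>T * (Q * Q) * X"
    using Q(1) d sq by (simp add: transpose_mult_dim mat_assoc)
  then have "(X\<^sup>T * Q * X) $$ (k, k) = ((Q * X)\<^sup>T * (Q * X)) $$ (k, k)" unfolding Q(2) by simp
  also have "\<dots> = (\<Sum>i<dim_row Q. ((Q * X) $$ (i, k))\<^sup>2)"
    using k by (subst mat_mult_index) (simp_all add: power2_eq_square del: index_mult_mat(1))
  also have "\<dots> = (\<Sum>i<dim_row Q. ((Q * col_mat X k) $$ (i, 0))\<^sup>2)"
    using col_mat_mult[OF k, of _ Q] d sq by (intro sum.cong refl) (simp del: index_mult_mat(1))
  also have "\<dots> = fnorm2 (Q * col_mat X k)"
    unfolding fnorm2_def by (simp add: col_mat_def del: index_mult_mat(1))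
  finally show ?thesis .
qed

section \<open>The Eckart-Young lower bound\<close>

lemma weighted_sum_sorted_ge:
  fixes d q :: "nat \<Rightarrow> real"
  assumes dec: "\<And>i j. i \<le> j \<Longrightarrow> j < n \<Longrightarrow> d j \<le> d i"
    and nonneg: "\<And>i. i < n \<Longrightarrow> 0 \<le> d i"
    and q: "\<And>i. i < n \<Longrightarrow> 0 \<le> q i" "\<And>i. i < n \<Longrightarrow> q i \<le> 1"
    and total: "(\<Sum>i<n. q i) \<ge> real n - real R"
  shows "(\<Sum>i<n. d i * q i) \<ge> (\<Sum>i\<in>{R..<n}. d i)"
proof (cases "R < n")
  case False
  then show ?thesis using nonneg q by (auto intro!: sum_nonneg)
next
  case True
  have split: "sum f {..<n} = sum f {..<R} + sum f {R..<n}" for f :: "nat \<Rightarrow> real"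
    using True sum.atLeastLessThan_concat[of 0 R n f] by (simp add: atLeast0LessThan)
  \<comment> \<open>The weight missing on the indices from \<open>R\<close> on is at most the weight present below \<open>R\<close>, and
    \<open>d R\<close> separates the values of \<open>d\<close> on the two sides.\<close>
  have "(\<Sum>i\<in>{R..<n}. d i * (1 - q i)) \<le> (\<Sum>i\<in>{R..<n}. d R * (1 - q i))"
    using dec q by (intro sum_mono mult_right_mono) auto
  also have "\<dots> = d R * (real (n - R) - (\<Sum>i\<in>{R..<n}. q i))"
    by (simp add: sum_subtractf flip: sum_distrib_left)
  also have "\<dots> \<le> d R * (\<Sum>i<R. q i)"
    using total True nonneg[of R] by (intro mult_left_mono) (auto simp: split of_nat_diff)
  also have "\<dots> \<le> (\<Sum>i<R. d i * q i)"
    unfolding sum_distrib_left using dec True q by (intro sum_mono mult_right_mono) auto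
  finally show ?thesis by (simp add: split algebra_simps sum_subtractf)
qed

lemma weighted_sum_list_ge:
  fixes e :: "real list" and q :: "nat \<Rightarrow> real"
  assumes nonneg: "\<And>x. x \<in> set e \<Longrightarrow> 0 \<le> x"
    and q: "\<And>i. i < length e \<Longrightarrow> 0 \<le> q i" "\<And>i. i < length e \<Longrightarrow> q i \<le> 1"
    and total: "(\<Sum>i<length e. q i) \<ge> real (length e) - real R"
  shows "(\<Sum>i<length e. (e ! i)\<^sup>2 * q i) \<ge> (\<Sum>i\<in>{R..<length e}. (rev (sort e) ! i)\<^sup>2)"
proof -
  have "mset (rev (sort e)) = mset e" by simp
  then obtain p where p: "p permutes {..<length e}" "permute_list p e = rev (sort e)"
    by (rule mset_eq_permutation)
  have nth: "rev (sort e) ! i = e ! p i" if "i < length e" for i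
    using permute_list_nth[OF p(1) that] p(2) by simp
  have pl: "p i < length e" if "i < length e" for i
    using permutes_in_image[OF p(1), of i] that by simp
  have reindex: "(\<Sum>i<length e. f (p i)) = (\<Sum>i<length e. f i)" for f :: "nat \<Rightarrow> real"
    using sum.permute[OF p(1), of f] by (simp add: o_def)
  have nn: "0 \<le> rev (sort e) ! i" if "i < length e" for i
    using nth[OF that] nonneg nth_mem[OF pl[OF that]] by simp
  have dec: "rev (sort e) ! j \<le> rev (sort e) ! i" if "i \<le> j" "j < length e" for i j
    using that sorted_nth_mono[OF sorted_sort[of e], of "length e - Suc j" "length e - Suc i"]
    by (simp add: rev_nth)
  have "(\<Sum>i\<in>{R..<length e}. (rev (sort e) ! i)\<^sup>2) \<le> (\<Sum>i<length e. (rev (sort e) ! i)\<^sup>2 * q (p i))"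
    using dec nn q pl total
    by (intro weighted_sum_sorted_ge power_mono) (auto simp: reindex)
  also have "\<dots> = (\<Sum>i<length e. (e ! p i)\<^sup>2 * q (p i))" using nth by simp
  also have "\<dots> = (\<Sum>i<length e. (e ! i)\<^sup>2 * q i)"
    by (rule reindex)
  finally show ?thesis .
qed

lemma singular_values_spectral:
  fixes A :: "real mat"
  assumes A: "A \<in> carrier_mat J K" and U: "U \<in> carrier_mat K K" "U\<^sup>T * U = 1\<^sub>m K"
    and AU: "A\<^sup>T * A = U * mat_diag K d * U\<^sup>T"
  shows "singular_values A = take (min J K) (rev (sort (map (\<lambda>i. sqrt (d i)) [0..<K])))"
proof -
  have UU: "U * U\<^sup>T = 1\<^sub>m K" using mat_mult_left_right_inverse[of "U\<^sup>T" K U] U by simp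
  have "similar_mat (A\<^sup>T * A) (mat_diag K d)"
    using A U UU AU by (intro similar_matI[of _ _ U "U\<^sup>T" K]) auto
  then have "char_poly (A\<^sup>T * A) = char_poly (mat_diag K d)" by (rule char_poly_similar)
  also have "\<dots> = (\<Prod>a\<leftarrow>diag_mat (mat_diag K d). [:- a, 1:])"
    by (rule char_poly_upper_triangular[OF mat_diag_dim]) (auto simp: mat_diag_def)
  also have "diag_mat (mat_diag K d) = map d [0..<K]"
    unfolding diag_mat_def by (simp add: mat_diag_def)
  finally have "proots (char_poly (A\<^sup>T * A)) = proots (\<Prod>a\<leftarrow>map d [0..<K]. [:- a, 1:])" by simp
  also have "proots (\<Prod>a\<leftarrow>xs. [:- a, 1:]) = mset xs" for xs :: "real list"
  proof (induction xs)
    case (Cons a xs)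
    have "(\<Prod>a\<leftarrow>xs. [:- a, 1:]) \<noteq> 0" by (auto simp: prod_list_zero_iff)
    then have "proots ([:- a, 1:] * (\<Prod>a\<leftarrow>xs. [:- a, 1:])) = {#a#} + mset xs"
      using Cons.IH by (subst proots_mult) auto
    then show ?case by simp
  qed simp
  finally have "image_mset sqrt (proots (char_poly (A\<^sup>T * A))) = mset (map (\<lambda>i. sqrt (d i)) [0..<K])"
    by (simp add: multiset.map_comp o_def)
  then show ?thesis unfolding singular_values_def using A
    by (simp only: sorted_list_of_multiset_mset carrier_matD)
qed

text \<open>
The product \<open>Y * Z\<close> ranges over the matrices of rank at most \<open>R\<close>.
\<close>
theorem eckart_young_lower:
  fixes A Y Z :: "real mat"
  assumes A: "A \<in> carrier_mat J K" and Y: "Y \<in> carrier_mat J R" and Z: "Z \<in> carrier_mat R K"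
  shows "(\<Sum>k = R + 1..min J K. (singular_value A k)\<^sup>2) \<le> fnorm2 (A - Y * Z)"
proof -
  have c: "dim_row A = J" "dim_col A = K" "dim_row Y = J" "dim_col Y = R" "dim_row Z = R" "dim_col Z = K"
    using A Y Z by auto
  have "A\<^sup>T * A \<in> carrier_mat K K" "(A\<^sup>T * A)\<^sup>T = A\<^sup>T * A"
    using c by (auto simp: transpose_mult_dim intro!: carrier_matI)
  from real_spectral[OF this] obtain U d where U: "U \<in> carrier_mat K K" "U\<^sup>T * U = 1\<^sub>m K"
    and AU: "A\<^sup>T * A = U * mat_diag K d * U\<^sup>T" by blast
  have cU: "dim_row U = K" "dim_col U = K" using U by auto
  have dn: "0 \<le> d k" if "k < K" for k using gram_eigenvalue_nonneg[OF AU U(2,1) that] .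
  define e where "e = map (\<lambda>i. sqrt (d i)) [0..<K]"
  have len: "length e = K" by (simp add: e_def)
  have sv: "singular_value A k = rev (sort e) ! (k - 1)" if "k \<in> {R + 1..min J K}" for k
  proof -
    have "k - 1 < min J K" using that by auto
    then show ?thesis
      by (simp only: singular_value_def e_def singular_values_spectral[OF A U AU] nth_take)
  qed
  obtain Q where Q: "Q \<in> carrier_mat K K" "Q\<^sup>T = Q" "Q * Q = Q" "Q * Z\<^sup>T = 0\<^sub>m K R"
    and trQ: "tr Q \<ge> real K - real R"
    using residual_projection[of "Z\<^sup>T" K R] Z by auto
  have cQ: "dim_row Q = K" "dim_col Q = K" using Q by auto
  \<comment> \<open>\<open>q k\<close> is the squared length of the projection by \<open>Q\<close> of the eigenvector in column \<open>k\<close> of \<open>U\<close>.\<close>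
  define q where "q k = (U\<^sup>T * Q * U) $$ (k, k)" for k
  have q_eq: "q k = fnorm2 (Q * col_mat U k)" if "k < K" for k
    unfolding q_def using that Q cU cQ by (intro projection_diag_entry) simp_all
  have q0: "0 \<le> q k" if "k < K" for k using q_eq[OF that] fnorm2_nonneg by simp
  have q1: "q k \<le> 1" if "k < K" for k
  proof -
    have "q k \<le> fnorm2 (col_mat U k)" unfolding q_eq[OF that]
      by (rule fnorm2_projection_le[OF Q(2,3)]) (simp add: col_mat_def cU cQ)
    also have "\<dots> = 1" using that cU U(2) by (simp add: fnorm2_col_mat)
    finally show ?thesis .
  qed
  have UU: "U * U\<^sup>T = 1\<^sub>m K" using mat_mult_left_right_inverse[of "U\<^sup>T" K U] U by simp
  have "(\<Sum>k<K. q k) = tr (U\<^sup>T * (Q * U))"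
    unfolding tr_def q_def using cU cQ by (simp add: mat_assoc del: index_mult_mat(1))
  also have "\<dots> = tr (Q * (U * U\<^sup>T))"
    using tr_comm[of "U\<^sup>T" "Q * U"] cU cQ by (simp add: mat_assoc)
  also have "\<dots> = tr Q" unfolding UU using Q(1) by simp
  finally have qsum: "(\<Sum>k<K. q k) \<ge> real K - real R" using trQ by simp
  have "(\<Sum>k = R + 1..min J K. (singular_value A k)\<^sup>2)
      = (\<Sum>k = R + 1..min J K. (rev (sort e) ! (k - 1))\<^sup>2)" using sv by simp
  also have "\<dots> = (\<Sum>i\<in>{R..<min J K}. (rev (sort e) ! i)\<^sup>2)"
    by (rule sum.reindex_bij_witness[of _ Suc "\<lambda>k. k - 1"]) auto
  also have "\<dots> \<le> (\<Sum>i\<in>{R..<K}. (rev (sort e) ! i)\<^sup>2)"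
    \<comment> \<open>The indices between \<open>min J K\<close> and \<open>K\<close> only contribute nonnegative terms.\<close>
    by (rule sum_mono2) auto
  also have "\<dots> \<le> (\<Sum>i<K. (e ! i)\<^sup>2 * q i)"
  proof -
    have "0 \<le> x" if "x \<in> set e" for x using that dn by (auto simp: e_def)
    then show ?thesis using weighted_sum_list_ge[of e q R] q0 q1 qsum len by simp
  qed
  also have "\<dots> = (\<Sum>i<K. d i * q i)" using dn by (simp add: e_def)
  also have "\<dots> = tr (Q * (A\<^sup>T * A))"
    unfolding AU q_def by (rule tr_conj_diag[OF U(1) Q(1), symmetric])
  also have "\<dots> = fnorm2 (Q * A\<^sup>T)"
    using fnorm2_projection_tr[OF Q(2,3), of "A\<^sup>T"] c cQ by simp
  also have "Q * A\<^sup>T = Q * (A - Y * Z)\<^sup>T"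
  proof -
    have "(A - Y * Z)\<^sup>T = A\<^sup>T - (Y * Z)\<^sup>T"
      by (rule transpose_minus[of _ J K]; rule carrier_matI; simp add: c)
    then have "Q * (A - Y * Z)\<^sup>T = Q * A\<^sup>T - Q * (Z\<^sup>T * Y\<^sup>T)"
      using c cQ by (simp add: transpose_mult_dim mult_minus_dim)
    also have "Q * (Z\<^sup>T * Y\<^sup>T) = 0\<^sub>m K J"
      using mat_assoc[of Q "Z\<^sup>T" "Y\<^sup>T"] c cQ Q(4) by (simp add: left_mult_zero_mat')
    also have "Q * A\<^sup>T - 0\<^sub>m K J = Q * A\<^sup>T"
      using c cQ by (intro eq_matI) (simp_all del: index_mult_mat(1))
    finally show ?thesis by simp
  qed
  also have "fnorm2 (Q * (A - Y * Z)\<^sup>T) \<le> fnorm2 ((A - Y * Z)\<^sup>T)"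
    using c cQ by (intro fnorm2_projection_le[OF Q(2,3)]) simp
  also have "\<dots> = fnorm2 (A - Y * Z)" by (rule fnorm2_transpose)
  finally show ?thesis .
qed

section \<open>Least squares for the tensor decomposition\<close>

lemma mixed_radix_less:
  assumes "j < J" "k < K" shows "j + k * J < J * (K :: nat)"
proof -
  have "j + k * J < Suc k * J" using assms by simp
  also have "\<dots> \<le> K * J" using assms by (intro mult_right_mono) auto
  finally show ?thesis by (simp add: mult.commute)
qed

lemma sum_mixed_radix:
  fixes f :: "nat \<Rightarrow> 'a :: comm_monoid_add"
  shows "(\<Sum>p<J * K. f p) = (\<Sum>j<J. \<Sum>k<K. f (j + k * J))"
proof -
  have "(\<Sum>j<J. \<Sum>k<K. f (j + k * J)) = (\<Sum>(j, k)\<in>{..<J} \<times> {..<K}. f (j + k * J))"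
    by (rule sum.cartesian_product)
  also have "\<dots> = (\<Sum>p<J * K. f p)"
    by (rule sum.reindex_bij_witness[of _ "\<lambda>p. (p mod J, p div J)" "\<lambda>(j, k). j + k * J"])
       (auto simp: mixed_radix_less less_mult_imp_div_less mult.commute intro!: mod_less_divisor gr0I)
  finally show ?thesis by simp
qed

text \<open>
The tensor as a matrix whose \<open>i\<close>-th column is the slice \<open>T i\<close>, vectorised with the first of its two
indices running fastest.
\<close>
definition unfolding_mat :: "nat \<Rightarrow> nat \<Rightarrow> nat \<Rightarrow> (nat \<Rightarrow> nat \<Rightarrow> nat \<Rightarrow> real) \<Rightarrow> real mat" where
  "unfolding_mat I J K T = mat (J * K) I (\<lambda>(p, i). T i (p mod J) (p div J))"

text \<open>
The Khatri-Rao product of \<open>C\<close> and \<open>B\<close>: its \<open>r\<close>-th column is the vectorised outer product of the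
\<open>r\<close>-th columns of \<open>B\<close> and \<open>C\<close>, in the same order of the entries.
\<close>
definition khatri_rao :: "nat \<Rightarrow> nat \<Rightarrow> nat \<Rightarrow> real mat \<Rightarrow> real mat \<Rightarrow> real mat" where
  "khatri_rao J K R B C = mat (J * K) R (\<lambda>(p, r). B $$ (p mod J, r) * C $$ (p div J, r))"

lemma slice_gram_eq: "slice_gram I J K T = unfolding_mat I J K T * (unfolding_mat I J K T)\<^sup>T"
  by (rule eq_matI) (simp_all add: slice_gram_def unfolding_mat_def scalar_prod_def atLeast0LessThan)

lemma cost_eq_fnorm2:
  assumes "A \<in> carrier_mat I R"
  shows "cost I J K R T A B C
    = 1 / 2 * fnorm2 (unfolding_mat I J K T - khatri_rao J K R B C * A\<^sup>T)"
proof -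
  let ?D = "unfolding_mat I J K T - khatri_rao J K R B C * A\<^sup>T"
  have entry: "?D $$ (j + k * J, i)
      = T i j k - (\<Sum>r<R. A $$ (i, r) * B $$ (j, r) * C $$ (k, r))"
    if "i < I" "j < J" "k < K" for i j k
    using that assms mixed_radix_less[OF that(2,3)]
    by (simp add: unfolding_mat_def khatri_rao_def mat_mult_index mult_ac del: index_mult_mat(1))
  have "fnorm2 ?D = (\<Sum>p<J * K. \<Sum>i<I. (?D $$ (p, i))\<^sup>2)"
    unfolding fnorm2_def using assms
    by (simp add: unfolding_mat_def khatri_rao_def del: index_mult_mat(1) index_minus_mat(1))
  also have "\<dots> = (\<Sum>i<I. \<Sum>p<J * K. (?D $$ (p, i))\<^sup>2)" by (rule sum.swap)
  also have "\<dots> = (\<Sum>i<I. \<Sum>j<J. \<Sum>k<K. (?D $$ (j + k * J, i))\<^sup>2)" by (simp only: sum_mixed_radix)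
  also have "\<dots> = (\<Sum>i<I. \<Sum>j<J. \<Sum>k<K.
      (T i j k - (\<Sum>r<R. A $$ (i, r) * B $$ (j, r) * C $$ (k, r)))\<^sup>2)"
    by (intro sum.cong refl) (simp only: entry lessThan_iff)
  finally show ?thesis by (simp add: cost_def)
qed

lemma cost_red_eq_projection:
  assumes Q: "Q\<^sup>T = Q" "Q * Q = Q" "Q * W = 0\<^sub>m (J * K) R" "Q = 1\<^sub>m (J * K) - W * G"
    and G: "G \<in> carrier_mat R (J * K)" and W: "W = khatri_rao J K R B C"
  shows "cost_red I J K R T B C = 1 / 2 * fnorm2 (Q * unfolding_mat I J K T)"
proof -
  define X where "X = unfolding_mat I J K T"
  have c: "dim_row X = J * K" "dim_col X = I" "dim_row W = J * K" "dim_col W = R"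
    "dim_row G = R" "dim_col G = J * K"
    using W G by (auto simp: X_def unfolding_mat_def khatri_rao_def)
  have cQ: "dim_row Q = J * K" "dim_col Q = J * K" using c by (simp_all add: Q(4))
  show ?thesis unfolding cost_red_def X_def[symmetric]
  proof (rule Least_equality)
    have "Q * X = X - W * (G * X)"
      unfolding Q(4) using c by (simp add: minus_mult_dim mat_assoc left_mult_one_mat')
    moreover have "(G * X)\<^sup>T \<in> carrier_mat I R" using c by (intro carrier_matI) simp_all
    ultimately show "\<exists>A\<in>carrier_mat I R. 1 / 2 * fnorm2 (Q * X) = cost I J K R T A B C"
      by (intro bexI[of _ "(G * X)\<^sup>T"]) (simp_all add: cost_eq_fnorm2 X_def W)
  next
    fix y assume "\<exists>A\<in>carrier_mat I R. y = cost I J K R T A B C"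
    then obtain A where A: "A \<in> carrier_mat I R" "y = cost I J K R T A B C" by blast
    have cA: "dim_row A = I" "dim_col A = R" using A by auto
    have "Q * (X - W * A\<^sup>T) = Q * X - (Q * W) * A\<^sup>T"
      using c cQ cA by (simp add: mult_minus_dim mat_assoc)
    also have "\<dots> = Q * X" unfolding Q(3) using c cQ cA
      by (intro eq_matI) (simp_all add: left_mult_zero_mat' del: index_mult_mat(1))
    finally have "fnorm2 (Q * X) = fnorm2 (Q * (X - W * A\<^sup>T))" by simp
    also have "\<dots> \<le> fnorm2 (X - W * A\<^sup>T)"
      using c cQ cA by (intro fnorm2_projection_le[OF Q(1,2)]) simp
    finally show "1 / 2 * fnorm2 (Q * X) \<le> y"
      unfolding A(2) cost_eq_fnorm2[OF A(1)] X_def W by simp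
  qed
qed

text \<open>
A linear combination of the columns of \<open>khatri_rao J K R B C\<close> is the vectorisation of a product
\<open>B * Z\<close>, so the residual of a vector is bounded below by \<open>eckart_young_lower\<close>.
\<close>
lemma khatri_rao_residual_ge:
  assumes Q: "Q = 1\<^sub>m (J * K) - khatri_rao J K R B C * G" and G: "G \<in> carrier_mat R (J * K)"
    and B: "B \<in> carrier_mat J R" and V: "dim_row V = J * K" "m < dim_col V"
  shows "(\<Sum>k = R + 1..min J K. (singular_value (matricization J K (col V m)) k)\<^sup>2)
    \<le> fnorm2 (Q * col_mat V m)"
proof -
  define x where "x = col_mat V m"
  define g where "g = G * x"
  define Z where "Z = mat R K (\<lambda>(r, k). g $$ (r, 0) * C $$ (k, r))"
  let ?W = "khatri_rao J K R B C" and ?A = "matricization J K (col V m)"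
  have c: "dim_row x = J * K" "dim_col x = 1" "dim_row G = R" "dim_col G = J * K"
    "dim_row g = R" "dim_col g = 1" "dim_row ?W = J * K" "dim_col ?W = R"
    using V G by (auto simp: x_def g_def col_mat_def khatri_rao_def)
  have Qx: "Q * x = x - ?W * g"
    unfolding Q g_def using c by (simp add: minus_mult_dim mat_assoc left_mult_one_mat')
  have dims: "dim_row (Q * x) = J * K" "dim_col (Q * x) = 1" unfolding Qx using c by simp_all
  have entry: "(Q * x) $$ (j + k * J, 0) = (?A - B * Z) $$ (j, k)" if "j < J" "k < K" for j k
  proof -
    have "(Q * x) $$ (j + k * J, 0) = V $$ (j + k * J, m)
        - (\<Sum>r<R. B $$ (j, r) * C $$ (k, r) * g $$ (r, 0))"
      unfolding Qx using that c mixed_radix_less[OF that] V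
      by (simp add: mat_mult_index del: index_mult_mat(1))
         (simp add: x_def col_mat_def khatri_rao_def)
    also have "\<dots> = (?A - B * Z) $$ (j, k)"
      using that mixed_radix_less[OF that] V B
      by (simp add: mat_mult_index matricization_def Z_def mult_ac del: index_mult_mat(1))
    finally show ?thesis .
  qed
  have "(\<Sum>k = R + 1..min J K. (singular_value ?A k)\<^sup>2) \<le> fnorm2 (?A - B * Z)"
    by (rule eckart_young_lower[OF _ B]) (simp_all add: matricization_def Z_def)
  also have "\<dots> = (\<Sum>j<J. \<Sum>k<K. ((?A - B * Z) $$ (j, k))\<^sup>2)"
    unfolding fnorm2_def using B by (simp add: Z_def del: index_mult_mat(1) index_minus_mat(1))
  also have "\<dots> = (\<Sum>p<J * K. ((Q * x) $$ (p, 0))\<^sup>2)"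
    unfolding sum_mixed_radix using entry by (intro sum.cong refl) simp
  also have "\<dots> = fnorm2 (Q * x)" unfolding fnorm2_def dims by simp
  finally show ?thesis unfolding x_def .
qed

theorem corollary4p1:
  fixes I J K R :: nat
    and T :: "nat \<Rightarrow> nat \<Rightarrow> nat \<Rightarrow> real"
    and V :: "real mat"
    and l :: "nat \<Rightarrow> real"
  assumes "I \<ge> 1" and "J \<ge> 1" and "K \<ge> 1" and "R \<ge> 1"
    and "V \<in> carrier_mat (J * K) (J * K)"
    and "transpose_mat V * V = 1\<^sub>m (J * K)"
    and "slice_gram I J K T = V * mat_diag (J * K) l * transpose_mat V"
  shows "(INF (B, C) \<in> carrier_mat J R \<times> carrier_mat K R. cost_red I J K R T B C)
    \<ge> 1 / 2 * (\<Sum>i<J * K. l i *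
        (\<Sum>k = R + 1..min J K. (singular_value (matricization J K (col V i)) k)\<^sup>2))"
proof (rule cINF_greatest)
  show "carrier_mat J R \<times> carrier_mat K R \<noteq> ({} :: (real mat \<times> real mat) set)"
    using zero_carrier_mat by blast
next
  fix BC :: "real mat \<times> real mat" assume "BC \<in> carrier_mat J R \<times> carrier_mat K R"
  then obtain B C where BC: "BC = (B, C)" and B: "B \<in> carrier_mat J R" by auto
  let ?X = "unfolding_mat I J K T" and ?W = "khatri_rao J K R B C"
  have "?W \<in> carrier_mat (J * K) R" by (simp add: khatri_rao_def)
  from residual_projection[OF this] obtain Q G
    where Q: "Q \<in> carrier_mat (J * K) (J * K)" "Q\<^sup>T = Q" "Q * Q = Q" "Q * ?W = 0\<^sub>m (J * K) R"
      "Q = 1\<^sub>m (J * K) - ?W * G" and G: "G \<in> carrier_mat R (J * K)" by blast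
  have V: "dim_row V = J * K" "dim_col V = J * K" using assms(5) by auto
  have gram: "?X\<^sup>T\<^sup>T * ?X\<^sup>T = V * mat_diag (J * K) l * V\<^sup>T"
    using assms(7) by (simp add: slice_gram_eq)
  have "(\<Sum>i<J * K. l i * (\<Sum>k = R + 1..min J K. (singular_value (matricization J K (col V i)) k)\<^sup>2))
      \<le> (\<Sum>i<J * K. l i * (V\<^sup>T * Q * V) $$ (i, i))"
  proof (intro sum_mono mult_left_mono)
    fix i assume "i \<in> {..<J * K}"
    then have i: "i < J * K" by simp
    show "0 \<le> l i" by (rule gram_eigenvalue_nonneg[OF gram assms(6,5) i])
    show "(\<Sum>k = R + 1..min J K. (singular_value (matricization J K (col V i)) k)\<^sup>2)
        \<le> (V\<^sup>T * Q * V) $$ (i, i)"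
      using khatri_rao_residual_ge[OF Q(5) G B V(1), of i] projection_diag_entry[OF Q(2,3), of V i]
        i V Q(1) by (simp del: index_mult_mat(1))
  qed
  \<comment> \<open>The two expressions for the Gram matrix of the slices, the spectral one and \<open>X * X\<^sup>T\<close>, are
    compared through the trace against \<open>Q\<close>.\<close>
  also have "\<dots> = tr (Q * slice_gram I J K T)"
    unfolding assms(7) by (rule tr_conj_diag[OF assms(5) Q(1), symmetric])
  also have "\<dots> = fnorm2 (Q * ?X)"
    using fnorm2_projection_tr[OF Q(2,3), of ?X] Q(1) by (simp add: slice_gram_eq unfolding_mat_def)
  finally show "1 / 2 * (\<Sum>i<J * K. l i *
        (\<Sum>k = R + 1..min J K. (singular_value (matricization J K (col V i)) k)\<^sup>2))
      \<le> (case BC of (B, C) \<Rightarrow> cost_red I J K R T B C)"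
    using cost_red_eq_projection[OF Q(2,3,4,5) G refl, of I T] by (simp add: BC)
qed

end
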